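(* Let $q>2$ be a power of $2$, let $\delta\in\mathbb{F}_q$ have absolute trace $1$, and let $\epsilon\in\mathbb{F}_{q^2}\setminus\mathbb{F}_q$ satisfy $\epsilon^2+\epsilon+\delta=0$. Let $a=a_0+\epsilon a_1\in\mathbb{F}_{q^2}^*$ and $b=b_0+\epsilon b_1\in\mathbb{F}_{q^2}\setminus\mathbb{F}_q$ ($a_i,b_i\in\mathbb{F}_q$), and let $\mathcal{B}_{a,b}$ be the surface of $\mathrm{PG}(3,q^2)$ with equation \[ Z^qJ^q-ZJ^{2q-1}+a^q(X^{2q}+Y^{2q})-a(X^2+Y^2)J^{2q-2}=(b^q-b)(X^{q+1}+Y^{q+1})J^{q-1}. \] Then, in the Barlotti--Cofman representation in $\mathrm{PG}(6,q)$, $\mathcal{B}_{a,b}$ is completely determined by the quadratic cone $\mathcal{B}'$ with equation \[ x_0x_6+a_0(x_2^2+x_4^2)+a_1(x_1^2+x_2^2+\delta x_2^2+x_3^2+x_4^2+\delta x_4^2)+b_1(x_1^2+\delta x_2^2+x_1x_2+x_3^2+\delta x_4^2+x_3x_4)=0, \] whose base is a non-degenerate hyperbolic quadric and whose vertex is $V=(0,0,0,0,0,1,0)$: the affine points of $\mathcal{B}_{a,b}$ correspond to the affine points of $\mathcal{B}'$, and the points at infinity of $\mathcal{B}_{a,b}$ are represented by $q^2+1$ lines of the spread $\mathcal{S}$, all entirely contained in $\mathcal{B}'$.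
   Context: Points of $\mathrm{PG}(3,q^2)$ have homogeneous coordinates $(J,X,Y,Z)$, with plane at infinity $J=0$; points of $\mathrm{PG}(6,q)$ have homogeneous coordinates $(x_0,\dots,x_6)$, with hyperplane at infinity $x_0=0$. Every $c\in\mathbb{F}_{q^2}$ is written uniquely as $c=c_0+\epsilon c_1$, $c_0,c_1\in\mathbb{F}_q$. Barlotti--Cofman representation: the affine point $(1,X,Y,Z)$ with $X=x_1+\epsilon x_2$, $Y=x_3+\epsilon x_4$, $Z=x_5+\epsilon x_6$ corresponds to $(1,x_1,\dots,x_6)$; a point $P=(0,u,v,w)$ at infinity corresponds to the spread line $r_P$ of $\{x_0=0\}$ consisting of the points $(0,u'_0,u'_1,v'_0,v'_1,w'_0,w'_1)$ with $(u',v',w')=(\lambda u,\lambda v,\lambda w)$, $\lambda\in\mathbb{F}_{q^2}^*$. The lines $r_P$ form a Desarguesian line spread $\mathcal{S}$ of $\{x_0=0\}$. The base of the cone $\mathcal{B}'$ is the quadric of $\mathrm{PG}(5,q)$ in coordinates $x_0,x_1,x_2,x_3,x_4,x_6$ given by the same equation. *)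

theory Defs
  imports "HOL-Analysis.Cartesian_Space"
begin

definition field_embedding :: "('f::field \<Rightarrow> 'k::field) \<Rightarrow> bool" where
  "field_embedding \<iota> \<longleftrightarrow>
     (\<forall>x y. \<iota> (x + y) = \<iota> x + \<iota> y) \<and> (\<forall>x y. \<iota> (x * y) = \<iota> x * \<iota> y) \<and> \<iota> 1 = 1"

text \<open>The trace of the field with \<open>2 ^ h\<close> elements over its prime field.\<close>

definition abs_trace2 :: "nat \<Rightarrow> 'f::field \<Rightarrow> 'f" where
  "abs_trace2 h x = (\<Sum>i<h. x ^ (2 ^ i))"


text \<open>A point of the projective space of \<open>'a ^ 'n\<close> is a one-dimensional vector subspace;
  all other projective objects are sets of points.\<close>

definition point :: "'a::field ^ 'n \<Rightarrow> ('a ^ 'n) set" where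
  "point v = vec.span {v}"

definition pg_points :: "('a::field ^ 'n) set set" where
  "pg_points = {point v | v. v \<noteq> 0}"

definition pg_lines :: "('a::field ^ 'n) set set set" where
  "pg_lines = {{P \<in> pg_points. P \<subseteq> W} | W. vec.subspace W \<and> vec.dim W = 2}"

definition join :: "('a::field ^ 'n) set \<Rightarrow> ('a ^ 'n) set \<Rightarrow> ('a ^ 'n) set set" where
  "join P R = {S \<in> pg_points. S \<subseteq> vec.span (P \<union> R)}"

definition cone_over :: "('a::field ^ 'n) set \<Rightarrow> ('a ^ 'n) set set \<Rightarrow> ('a ^ 'n) set set" where
  "cone_over V B = (\<Union>P\<in>B. join V P)"

text \<open>Coordinates are numbered from \<open>0\<close> (the numerals \<open>0, \<dots>, n - 1\<close> of the index type \<open>n\<close>);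
  the hyperplane at infinity is given by the vanishing of coordinate \<open>0\<close>.\<close>

definition points_at_infinity :: "('a::field ^ 'n::{finite,zero}) set set" where
  "points_at_infinity = {P \<in> pg_points. \<forall>v\<in>P. v $ 0 = 0}"

definition affine_points :: "('a::field ^ 'n::{finite,zero}) set set" where
  "affine_points = pg_points - points_at_infinity"

definition hom4 :: "'a \<Rightarrow> 'a \<Rightarrow> 'a \<Rightarrow> 'a \<Rightarrow> 'a ^ 4" where
  "hom4 x0 x1 x2 x3 =
     (\<chi> i. if i = 0 then x0 else if i = 1 then x1 else if i = 2 then x2 else x3)"

definition hom7 :: "'a \<Rightarrow> 'a \<Rightarrow> 'a \<Rightarrow> 'a \<Rightarrow> 'a \<Rightarrow> 'a \<Rightarrow> 'a \<Rightarrow> 'a ^ 7" where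
  "hom7 x0 x1 x2 x3 x4 x5 x6 =
     (\<chi> i. if i = 0 then x0 else if i = 1 then x1 else if i = 2 then x2 else if i = 3 then x3
           else if i = 4 then x4 else if i = 5 then x5 else x6)"


definition quadratic_form :: "('a::field ^ 'n \<Rightarrow> 'a) \<Rightarrow> bool" where
  "quadratic_form Q \<longleftrightarrow> (\<exists>c. \<forall>v. Q v = (\<Sum>i\<in>UNIV. \<Sum>j\<in>UNIV. c i j * v $ i * v $ j))"

definition quadric :: "('a::field ^ 'n \<Rightarrow> 'a) \<Rightarrow> ('a ^ 'n) set set" where
  "quadric Q = {point v | v. v \<noteq> 0 \<and> Q v = 0}"

definition polar_form :: "('a::field ^ 'n \<Rightarrow> 'a) \<Rightarrow> 'a ^ 'n \<Rightarrow> 'a ^ 'n \<Rightarrow> 'a" where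
  "polar_form Q v w = Q (v + w) - Q v - Q w"

text \<open>The condition \<open>Q v = 0\<close> is needed in characteristic \<open>2\<close>, where it does not follow from
  \<open>v\<close> lying in the radical of the polar form.\<close>

definition nondegenerate :: "('a::field ^ 'n \<Rightarrow> 'a) \<Rightarrow> bool" where
  "nondegenerate Q \<longleftrightarrow> (\<forall>v. Q v = 0 \<and> (\<forall>w. polar_form Q v w = 0) \<longrightarrow> v = 0)"

definition witt_index :: "('a::field ^ 'n \<Rightarrow> 'a) \<Rightarrow> nat" where
  "witt_index Q = Max {vec.dim W | W. vec.subspace W \<and> (\<forall>w\<in>W. Q w = 0)}"

definition nondegenerate_hyperbolic :: "('a::field ^ 'n \<Rightarrow> 'a) \<Rightarrow> bool" where
  "nondegenerate_hyperbolic Q \<longleftrightarrow>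
     quadratic_form Q \<and> nondegenerate Q \<and> 2 * witt_index Q = CARD('n)"


text \<open>Throughout, \<open>\<iota>\<close> embeds the field of order \<open>q\<close> into the field of order \<open>q\<^sup>2\<close>, and
  \<open>(1, \<epsilon>)\<close> is a basis of the extension. \<open>coords \<iota> \<epsilon> c\<close> is the pair
  \<open>(c\<^sub>0, c\<^sub>1)\<close> with \<open>c = c\<^sub>0 + \<epsilon> c\<^sub>1\<close>.\<close>

definition coords :: "('f::field \<Rightarrow> 'k::field) \<Rightarrow> 'k \<Rightarrow> 'k \<Rightarrow> 'f \<times> 'f" where
  "coords \<iota> \<epsilon> c = (THE p. c = \<iota> (fst p) + \<epsilon> * \<iota> (snd p))"

definition bc_vec :: "('f::field \<Rightarrow> 'k::field) \<Rightarrow> 'k \<Rightarrow> 'f \<Rightarrow> 'k \<Rightarrow> 'k \<Rightarrow> 'k \<Rightarrow> 'f ^ 7" where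
  "bc_vec \<iota> \<epsilon> x0 X Y Z =
     hom7 x0 (fst (coords \<iota> \<epsilon> X)) (snd (coords \<iota> \<epsilon> X))
             (fst (coords \<iota> \<epsilon> Y)) (snd (coords \<iota> \<epsilon> Y))
             (fst (coords \<iota> \<epsilon> Z)) (snd (coords \<iota> \<epsilon> Z))"

text \<open>The Barlotti--Cofman representation of an affine point, and of a point at infinity.\<close>

definition bc_affine ::
    "('f::field \<Rightarrow> 'k::field) \<Rightarrow> 'k \<Rightarrow> ('k ^ 4) set \<Rightarrow> ('f ^ 7) set" where
  "bc_affine \<iota> \<epsilon> P =
     (THE R. \<exists>X Y Z. P = point (hom4 1 X Y Z) \<and> R = point (bc_vec \<iota> \<epsilon> 1 X Y Z))"

definition spread_line ::
    "('f::field \<Rightarrow> 'k::field) \<Rightarrow> 'k \<Rightarrow> ('k ^ 4) set \<Rightarrow> ('f ^ 7) set set" where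
  "spread_line \<iota> \<epsilon> P =
     {point (bc_vec \<iota> \<epsilon> 0 (l * u) (l * v) (l * w)) | l u v w.
        l \<noteq> 0 \<and> P = point (hom4 0 u v w)}"

definition spread :: "('f::field \<Rightarrow> 'k::field) \<Rightarrow> 'k \<Rightarrow> ('f ^ 7) set set set" where
  "spread \<iota> \<epsilon> = spread_line \<iota> \<epsilon> ` points_at_infinity"


definition B_surface :: "nat \<Rightarrow> 'k::field \<Rightarrow> 'k \<Rightarrow> ('k ^ 4) set set" where
  "B_surface q a b = {point (hom4 J X Y Z) | J X Y Z.
     hom4 J X Y Z \<noteq> 0 \<and>
     Z ^ q * J ^ q - Z * J ^ (2 * q - 1) + a ^ q * (X ^ (2 * q) + Y ^ (2 * q))
       - a * (X ^ 2 + Y ^ 2) * J ^ (2 * q - 2)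
     = (b ^ q - b) * (X ^ (q + 1) + Y ^ (q + 1)) * J ^ (q - 1)}"

definition cone_form :: "'f::field \<Rightarrow> 'f \<Rightarrow> 'f \<Rightarrow> 'f \<Rightarrow> 'f ^ 7 \<Rightarrow> 'f" where
  "cone_form \<delta> a0 a1 b1 x =
     x$0 * x$6 + a0 * ((x$2)^2 + (x$4)^2)
     + a1 * ((x$1)^2 + (x$2)^2 + \<delta> * (x$2)^2 + (x$3)^2 + (x$4)^2 + \<delta> * (x$4)^2)
     + b1 * ((x$1)^2 + \<delta> * (x$2)^2 + x$1 * x$2 + (x$3)^2 + \<delta> * (x$4)^2 + x$3 * x$4)"

text \<open>The identification of \<open>PG(5,q)\<close>, with coordinates named \<open>x\<^sub>0, x\<^sub>1, x\<^sub>2, x\<^sub>3, x\<^sub>4, x\<^sub>6\<close>,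
  with the hyperplane \<open>x\<^sub>5 = 0\<close> of \<open>PG(6,q)\<close>.\<close>

definition lift6 :: "'f::field ^ 6 \<Rightarrow> 'f ^ 7" where
  "lift6 y = hom7 (y$0) (y$1) (y$2) (y$3) (y$4) 0 (y$5)"

definition base_form :: "'f::field \<Rightarrow> 'f \<Rightarrow> 'f \<Rightarrow> 'f \<Rightarrow> 'f ^ 6 \<Rightarrow> 'f" where
  "base_form \<delta> a0 a1 b1 y = cone_form \<delta> a0 a1 b1 (lift6 y)"

end

theory Submission
  imports Defs
begin

text \<open>Conjugation over the field of order \<open>q\<close> sends \<open>\<epsilon>\<close> to \<open>\<epsilon> + 1\<close>, because \<open>\<delta>\<close> has absolute trace \<open>1\<close>;
  hence \<open>c\<^sup>q - c\<close> is the second coordinate of \<open>c\<close>, which is also its trace. The equation of the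
  surface at an affine point \<open>(1, X, Y, Z)\<close> therefore reads
  \<open>Tr Z + Tr (a (X + Y)\<^sup>2) + b\<^sub>1 (N X + N Y) = 0\<close>, and this is the equation of the cone. At infinity
  the surface reduces to \<open>X = Y\<close>. If all points of the spread line of \<open>(0, u, v, w)\<close> lie on the
  cone, then polarizing \<open>l \<mapsto> Tr (a l\<^sup>2 (u + v)\<^sup>2) + b\<^sub>1 N l (N u + N v)\<close> gives \<open>N u + N v = 0\<close>,
  after which non-degeneracy of the trace gives \<open>u = v\<close>.

  The base of the cone has the non-degenerate polar form
  \<open>v\<^sub>0 w\<^sub>5 + v\<^sub>5 w\<^sub>0 + b\<^sub>1 (v\<^sub>1 w\<^sub>2 + v\<^sub>2 w\<^sub>1 + v\<^sub>3 w\<^sub>4 + v\<^sub>4 w\<^sub>3)\<close> and is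
  hyperbolic since the quadratic form vanishes on the three-dimensional subspace
  \<open>y\<^sub>0 = 0, y\<^sub>1 = y\<^sub>3, y\<^sub>2 = y\<^sub>4\<close>.\<close>

section \<open>Coordinates and points\<close>

lemma exhaust_6: "(i::6) = 0 \<or> i = 1 \<or> i = 2 \<or> i = 3 \<or> i = 4 \<or> i = 5"
proof (induct i)
  case (of_int z)
  then have "0 \<le> z" and "z < 6" by simp_all
  then have "z = 0 \<or> z = 1 \<or> z = 2 \<or> z = 3 \<or> z = 4 \<or> z = 5" by arith
  then show ?case by auto
qed

lemma exhaust_7: "(i::7) = 0 \<or> i = 1 \<or> i = 2 \<or> i = 3 \<or> i = 4 \<or> i = 5 \<or> i = 6"
proof (induct i)
  case (of_int z)
  then have "0 \<le> z" and "z < 7" by simp_all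
  then have "z = 0 \<or> z = 1 \<or> z = 2 \<or> z = 3 \<or> z = 4 \<or> z = 5 \<or> z = 6" by arith
  then show ?case by auto
qed

text \<open>\<open>forall_4\<close> numbers the indices \<open>1, ..., 4\<close>; in the type
  \<open>4\<close> the numeral \<open>4\<close> is \<open>0\<close>.\<close>

lemma forall_4_from_0: "(\<forall>i::4. P i) \<longleftrightarrow> P 0 \<and> P 1 \<and> P 2 \<and> P 3"
proof -
  have "(4::4) = 0" by simp
  then show ?thesis unfolding forall_4 by metis
qed

lemma forall_6: "(\<forall>i::6. P i) \<longleftrightarrow> P 0 \<and> P 1 \<and> P 2 \<and> P 3 \<and> P 4 \<and> P 5"
  by (metis exhaust_6)

lemma forall_7: "(\<forall>i::7. P i) \<longleftrightarrow> P 0 \<and> P 1 \<and> P 2 \<and> P 3 \<and> P 4 \<and> P 5 \<and> P 6"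
  by (metis exhaust_7)

lemma UNIV_6: "UNIV = {0, 1, 2, 3, 4, 5::6}"
  using exhaust_6 by auto

lemma hom4_nth [simp]:
  "hom4 x0 x1 x2 x3 $ 0 = x0" "hom4 x0 x1 x2 x3 $ 1 = x1"
  "hom4 x0 x1 x2 x3 $ 2 = x2" "hom4 x0 x1 x2 x3 $ 3 = x3"
  by (simp_all add: hom4_def)

lemma hom7_nth [simp]:
  "hom7 x0 x1 x2 x3 x4 x5 x6 $ 0 = x0" "hom7 x0 x1 x2 x3 x4 x5 x6 $ 1 = x1"
  "hom7 x0 x1 x2 x3 x4 x5 x6 $ 2 = x2" "hom7 x0 x1 x2 x3 x4 x5 x6 $ 3 = x3"
  "hom7 x0 x1 x2 x3 x4 x5 x6 $ 4 = x4" "hom7 x0 x1 x2 x3 x4 x5 x6 $ 5 = x5"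
  "hom7 x0 x1 x2 x3 x4 x5 x6 $ 6 = x6"
  by (simp_all add: hom7_def)

lemma hom4_cases: obtains x0 x1 x2 x3 where "v = hom4 x0 x1 x2 x3"
proof
  show "v = hom4 (v$0) (v$1) (v$2) (v$3)"
    by (simp add: vec_eq_iff forall_4_from_0)
qed

lemma hom4_eq_iff [simp]:
  "hom4 x0 x1 x2 x3 = hom4 y0 y1 y2 y3 \<longleftrightarrow> x0 = y0 \<and> x1 = y1 \<and> x2 = y2 \<and> x3 = y3"
  by (simp add: vec_eq_iff forall_4_from_0)

lemma hom4_scale: "c *s hom4 x0 x1 x2 x3 = hom4 (c * x0) (c * x1) (c * x2) (c * x3)"
  by (simp add: vec_eq_iff forall_4_from_0)

lemma hom4_zero: "hom4 x0 x1 x2 x3 = 0 \<longleftrightarrow> x0 = 0 \<and> x1 = 0 \<and> x2 = 0 \<and> x3 = 0"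
  by (simp add: vec_eq_iff forall_4_from_0)

lemma hom7_eq_iff [simp]:
  "hom7 x0 x1 x2 x3 x4 x5 x6 = hom7 y0 y1 y2 y3 y4 y5 y6 \<longleftrightarrow>
     x0 = y0 \<and> x1 = y1 \<and> x2 = y2 \<and> x3 = y3 \<and> x4 = y4 \<and> x5 = y5 \<and> x6 = y6"
  by (simp add: vec_eq_iff forall_7)

lemma hom7_scale:
  "c *s hom7 x0 x1 x2 x3 x4 x5 x6 =
     hom7 (c * x0) (c * x1) (c * x2) (c * x3) (c * x4) (c * x5) (c * x6)"
  by (simp add: vec_eq_iff forall_7)

lemma hom7_add:
  "hom7 x0 x1 x2 x3 x4 x5 x6 + hom7 y0 y1 y2 y3 y4 y5 y6 =
     hom7 (x0 + y0) (x1 + y1) (x2 + y2) (x3 + y3) (x4 + y4) (x5 + y5) (x6 + y6)"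
  by (simp add: vec_eq_iff forall_7)

lemma hom7_zero:
  "hom7 x0 x1 x2 x3 x4 x5 x6 = 0 \<longleftrightarrow>
     x0 = 0 \<and> x1 = 0 \<and> x2 = 0 \<and> x3 = 0 \<and> x4 = 0 \<and> x5 = 0 \<and> x6 = 0"
  by (simp add: vec_eq_iff forall_7)

section \<open>Points and their homogeneous representatives\<close>

lemma point_eq_range: "point v = range (\<lambda>c. c *s v)"
  by (simp add: point_def vec.span_singleton)

lemma point_eq_iff:
  assumes "v \<noteq> 0"
  shows "point v = point w \<longleftrightarrow> (\<exists>c. c \<noteq> 0 \<and> v = c *s w)"
proof
  assume eq: "point v = point w"
  have "v \<in> point v" by (simp add: point_def vec.span_base)
  then obtain c where "v = c *s w" unfolding eq by (auto simp: point_eq_range)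
  with assms show "\<exists>c. c \<noteq> 0 \<and> v = c *s w" by auto
next
  assume "\<exists>c. c \<noteq> 0 \<and> v = c *s w"
  then obtain c where c: "c \<noteq> 0" "v = c *s w" by blast
  have "d *s w \<in> point v" for d
  proof -
    have "d *s w = (d / c) *s v" using c by (simp add: vector_smult_assoc)
    then show ?thesis by (auto simp: point_eq_range)
  qed
  moreover have "d *s v \<in> point w" for d
    using c by (auto simp: point_eq_range vector_smult_assoc)
  ultimately show "point v = point w" by (auto simp: point_eq_range)
qed

lemma point_subset_iff: "vec.subspace W \<Longrightarrow> point v \<subseteq> W \<longleftrightarrow> v \<in> W"
  unfolding point_def by (metis empty_subsetI insert_subset vec.span_minimal vec.span_superset subset_iff singletonI)

lemma point_in_pg_points: "v \<noteq> 0 \<Longrightarrow> point v \<in> pg_points"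
  by (auto simp: pg_points_def)

lemma point_in_infinity_iff:
  "v \<noteq> 0 \<Longrightarrow> point v \<in> points_at_infinity \<longleftrightarrow> v $ 0 = 0"
  using point_in_pg_points[of v]
  by (auto simp: points_at_infinity_def point_eq_range dest: spec[of _ 1])

text \<open>Another representative of the same point changes the value of \<open>Q\<close> by a
  nonzero square, so vanishing is a property of the point.\<close>

lemma quadric_point_iff:
  assumes "\<And>c v. Q (c *s v) = c\<^sup>2 * Q v" and "v \<noteq> 0"
  shows "point v \<in> quadric Q \<longleftrightarrow> Q v = 0"
proof
  assume "point v \<in> quadric Q"
  then obtain w where w: "point v = point w" "Q w = 0" by (auto simp: quadric_def)
  then obtain c where "v = c *s w" using point_eq_iff[OF assms(2)] by blast
  then show "Q v = 0" using assms(1) w by simp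
qed (use assms in \<open>auto simp: quadric_def\<close>)

lemma affine_points_iff: "P \<in> affine_points \<longleftrightarrow> (\<exists>v. v $ 0 = 1 \<and> P = point v)"
proof
  assume "P \<in> affine_points"
  then obtain v where v: "v \<noteq> 0" "P = point v" "v $ 0 \<noteq> 0"
    by (auto simp: affine_points_def pg_points_def point_in_infinity_iff)
  have "point v = point (inverse (v $ 0) *s v)"
    using v by (subst point_eq_iff) (auto intro!: exI[of _ "v $ 0"] simp: vector_smult_assoc)
  with v show "\<exists>v. v $ 0 = 1 \<and> P = point v"
    by (intro exI[of _ "inverse (v $ 0) *s v"]) simp
next
  assume "\<exists>v. v $ 0 = 1 \<and> P = point v"
  then obtain v where v: "v $ 0 = 1" "P = point v" by blast
  then have "v \<noteq> 0" by auto
  with v show "P \<in> affine_points"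
    by (simp add: affine_points_def point_in_pg_points point_in_infinity_iff)
qed

lemma points_at_infinity_iff:
  "P \<in> points_at_infinity \<longleftrightarrow> (\<exists>v. v \<noteq> 0 \<and> v $ 0 = 0 \<and> P = point v)"
proof
  assume P: "P \<in> points_at_infinity"
  then obtain v where "v \<noteq> 0" "P = point v"
    by (auto simp: points_at_infinity_def pg_points_def)
  with P show "\<exists>v. v \<noteq> 0 \<and> v $ 0 = 0 \<and> P = point v"
    using point_in_infinity_iff by blast
qed (auto simp: point_in_infinity_iff)

text \<open>Comparing coordinate \<open>0\<close> forces the proportionality factor to be
  \<open>1\<close>.\<close>

lemma point_normalized_inject:
  assumes "v $ 0 = 1" "w $ 0 = 1" shows "point v = point w \<longleftrightarrow> v = w"
proof
  assume "point v = point w"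
  moreover have "v \<noteq> 0" using assms by auto
  ultimately obtain c where "v = c *s w" using point_eq_iff by blast
  with assms show "v = w" by simp
qed simp

lemma pg_points_eq: "pg_points = affine_points \<union> points_at_infinity"
  by (auto simp: affine_points_def points_at_infinity_def)

section \<open>The base and the cone\<close>

text \<open>\<open>W\<close> maps injectively into the span of the vectors that complete one of its bases to a
  basis of the whole space: the vector \<open>w\<close> is determined by the values of \<open>\<beta> w\<close> on these.\<close>

lemma isotropic_dim_le:
  fixes \<beta> :: "'a::field ^ 'n \<Rightarrow> 'a ^ 'n \<Rightarrow> 'a"
  assumes addl: "\<And>x y z. \<beta> (x + y) z = \<beta> x z + \<beta> y z"
    and scalel: "\<And>c x z. \<beta> (c *s x) z = c * \<beta> x z"
    and addr: "\<And>x y z. \<beta> x (y + z) = \<beta> x y + \<beta> x z"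
    and scaler: "\<And>c x z. \<beta> x (c *s z) = c * \<beta> x z"
    and nondeg: "\<And>x. (\<And>y. \<beta> x y = 0) \<Longrightarrow> x = 0"
    and W: "vec.subspace W" and iso: "\<And>x y. x \<in> W \<Longrightarrow> y \<in> W \<Longrightarrow> \<beta> x y = 0"
  shows "2 * vec.dim W \<le> CARD('n)"
proof -
  obtain B where B: "B \<subseteq> W" "vec.independent B" "W \<subseteq> vec.span B" "card B = vec.dim W"
    using vec.basis_exists[of W] by metis
  define C where "C = vec.extend_basis B"
  have C: "B \<subseteq> C" "vec.independent C" "vec.span C = UNIV"
    using B(2) by (simp_all add: C_def vec.extend_basis_superset vec.independent_extend_basis)
  have fin: "finite C" using C(2) by (rule vec.finiteI_independent)
  have cardC: "card C = CARD('n)"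
    using vec.dim_eq_card_independent[OF C(2)] C(3) vec.dim_span[of C]
    by (metis vec.dim_UNIV card_cart_basis)
  define f where "f x = (\<Sum>b\<in>C - B. \<beta> x b *s b)" for x
  have lin: "Vector_Spaces.linear (*s) (*s) f"
    by unfold_locales
      (simp_all add: f_def addl scalel vec.scale_left_distrib sum.distrib
        vec.scale_sum_right)
  interpret f: Vector_Spaces.linear "(*s)" "(*s)" f by (rule lin)
  have zero: "x = 0" if "x \<in> W" "f x = 0" for x
  proof (rule nondeg)
    \<comment> \<open>Independence of \<open>C - B\<close> makes every coefficient of
      \<open>f x = 0\<close> vanish. On \<open>B\<close> the values vanish by isotropy, so
      \<open>\<beta> x\<close> is zero on the whole basis \<open>C\<close>.\<close>
    have "\<beta> x b = 0" if "b \<in> C - B" for b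
      using vec.independentD[of "C - B" "C - B" "\<beta> x"] \<open>f x = 0\<close> that C(2) fin
        vec.independent_mono[of C "C - B"] unfolding f_def by blast
    then have C0: "C \<subseteq> {z. \<beta> x z = 0}" using iso B(1) \<open>x \<in> W\<close> by blast
    have "vec.subspace {z. \<beta> x z = 0}"
      using scaler[of x 0 0] by (simp add: vec.subspace_def addr scaler)
    then show "\<beta> x y = 0" for y
      using vec.span_minimal[OF C0] C(3) by blast
  qed
  have inj: "inj_on f (vec.span W)"
    using zero W by (subst f.inj_on_iff_eq_0) (auto simp: vec.span_eq_iff[THEN iffD2])
  have "vec.dim W = vec.dim (f ` W)"
    by (rule vec.dim_image_eq[symmetric, OF lin inj])
  also have "\<dots> \<le> card (C - B)"
  proof (rule vec.dim_le_card)
    show "f ` W \<subseteq> vec.span (C - B)"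
      unfolding f_def
      by (intro image_subsetI vec.span_sum vec.span_scale vec.span_base)
  qed (use fin in simp)
  also have "\<dots> = CARD('n) - vec.dim W"
    using B(4) C(1) cardC fin by (metis card_Diff_subset finite_subset)
  finally show ?thesis
    using B(4) card_mono[OF fin C(1)] cardC by linarith
qed

section \<open>The cone and its vertex\<close>

lemma lift6_linear: "Vector_Spaces.linear (*s) (*s) lift6"
  by unfold_locales (simp_all add: lift6_def hom7_add hom7_scale vec_eq_iff forall_7 algebra_simps)

lemma lift6_eq_0_iff: "lift6 y = 0 \<longleftrightarrow> y = 0"
  by (simp add: lift6_def vec_eq_iff forall_6 forall_7)

lemma lift6_image_point: "lift6 ` point y = point (lift6 y)"
proof -
  interpret Vector_Spaces.linear "(*s)" "(*s)" lift6 by (rule lift6_linear)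
  show ?thesis by (auto simp: point_eq_range scale image_image)
qed

lemma point_in_join_iff:
  assumes "s \<noteq> 0"
  shows "point s \<in> join (point v) (point w) \<longleftrightarrow> (\<exists>c d. s = c *s v + d *s w)"
proof -
  have "vec.span (point v \<union> point w) = {x + y |x y. x \<in> point v \<and> y \<in> point w}"
    by (simp add: vec.span_Un point_def vec.span_span)
  moreover have "point s \<in> join (point v) (point w) \<longleftrightarrow> s \<in> vec.span (point v \<union> point w)"
    using assms
    by (simp add: join_def point_in_pg_points point_subset_iff[OF vec.subspace_span])
  ultimately show ?thesis by (auto simp: point_eq_range)
qed

lemma cone_form_scale: "cone_form d a0 a1 b1 (c *s v) = c\<^sup>2 * cone_form d a0 a1 b1 v"
  by (simp add: cone_form_def power2_eq_square algebra_simps)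

lemma base_form_scale: "base_form d a0 a1 b1 (c *s y) = c\<^sup>2 * base_form d a0 a1 b1 y"
proof -
  interpret Vector_Spaces.linear "(*s)" "(*s)" lift6 by (rule lift6_linear)
  show ?thesis by (simp add: base_form_def scale cone_form_scale)
qed

lemmas cone_quadric_iff =
  quadric_point_iff[of "cone_form d a0 a1 b1" for d a0 a1 b1, OF cone_form_scale]
lemmas base_quadric_iff =
  quadric_point_iff[of "base_form d a0 a1 b1" for d a0 a1 b1, OF base_form_scale]

text \<open>The form does not involve \<open>x$5\<close>, so it is constant along the direction of
  the vertex.\<close>

lemma cone_form_vertex_add:
  "cone_form d a0 a1 b1 (c *s hom7 0 0 0 0 0 1 0 + v) = cone_form d a0 a1 b1 v"
  by (simp add: cone_form_def)

text \<open>Every vector is a multiple of the vertex plus the lift of its other six coordinates, and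
  the form sees only the second summand.\<close>

lemma cone_over_base:
  "quadric (cone_form d a0 a1 b1) =
     cone_over (point (hom7 0 0 0 0 0 1 0)) ((`) lift6 ` quadric (base_form d a0 a1 b1))"
    (is "?B' = cone_over (point ?e) (_ ` ?Base)")
proof (intro equalityI subsetI)
  fix S assume "S \<in> ?B'"
  then obtain s where s: "S = point s" "s \<noteq> 0" "cone_form d a0 a1 b1 s = 0"
    by (auto simp: quadric_def)
  define y :: "'a ^ 6" where "y = (\<chi> i. if i = 0 then s$0 else if i = 1 then s$1 else
    if i = 2 then s$2 else if i = 3 then s$3 else if i = 4 then s$4 else s$6)"
  obtain p where sy: "s = p *s ?e + lift6 y"
  proof
    show "s = s$5 *s ?e + lift6 y" by (simp add: vec_eq_iff forall_7 lift6_def y_def)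
  qed
  show "S \<in> cone_over (point ?e) ((`) lift6 ` ?Base)"
  proof (cases "y = 0")
    case False
    have "base_form d a0 a1 b1 y = 0"
      using s(3) cone_form_vertex_add unfolding base_form_def by (metis sy)
    then have "point y \<in> ?Base" using False by (simp add: base_quadric_iff)
    moreover have "S \<in> join (point ?e) (lift6 ` point y)"
      unfolding s(1) lift6_image_point point_in_join_iff[OF s(2)]
      using sy by (intro exI[of _ p] exI[of _ 1]) simp
    ultimately show ?thesis by (auto simp: cone_over_def)
  next
    text \<open>Here \<open>S\<close> is the vertex, which lies on the line joining it to any point of the base.\<close>
    case True
    \<comment> \<open>The form has no term in the square of \<open>x$0\<close>, so this point lies
      on the base for all coefficients.\<close>
    let ?y = "axis 0 1 :: 'a ^ 6"
    have "base_form d a0 a1 b1 ?y = 0"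
      by (simp add: base_form_def lift6_def cone_form_def axis_def)
    then have "point ?y \<in> ?Base" by (simp add: base_quadric_iff axis_eq_0_iff)
    moreover have "s = p *s ?e + 0 *s lift6 ?y"
      using sy lift6_eq_0_iff[of y] True by simp
    then have "S \<in> join (point ?e) (lift6 ` point ?y)"
      unfolding s(1) lift6_image_point point_in_join_iff[OF s(2)] by blast
    ultimately show ?thesis by (auto simp: cone_over_def)
  qed
next
  fix S assume "S \<in> cone_over (point ?e) ((`) lift6 ` ?Base)"
  then obtain y where y: "y \<noteq> 0" "base_form d a0 a1 b1 y = 0"
    and S: "S \<in> join (point ?e) (point (lift6 y))"
    by (auto simp: cone_over_def quadric_def lift6_image_point)
  then obtain s where s: "s \<noteq> 0" "S = point s" by (auto simp: join_def pg_points_def)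
  then obtain c e where "s = c *s ?e + e *s lift6 y" using S point_in_join_iff by blast
  then have "cone_form d a0 a1 b1 s = 0"
    using y(2) by (simp only: cone_form_vertex_add cone_form_scale base_form_def) simp
  then show "S \<in> ?B'" using s by (simp add: cone_quadric_iff)
qed

section \<open>The type of the base quadric in characteristic two\<close>

lemma char_two:
  fixes x y :: "'a::field"
  assumes "(2::'a) = 0"
  shows "x + x = 0" "x + (x + y) = y" "- x = x" "x - y = x + y"
proof -
  show double: "x + x = 0" for x :: 'a using assms by (metis mult_2 mult_zero_left)
  \<comment> \<open>In this form, once \<open>ac_simps\<close> has brought equal summands together,
    a pair cancels inside a longer sum.\<close>
  show "x + (x + y) = y" using double by (simp flip: add.assoc)
  show "- x = x" using double by (simp add: minus_unique)
  then show "x - y = x + y" using double by (simp add: diff_eq_eq add.assoc)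
qed

text \<open>Squaring is additive here, so the square terms drop out and only the mixed products
  contribute.\<close>

lemma polar_form_base_form:
  fixes d :: "'a::field"
  assumes "(2::'a) = 0"
  shows "polar_form (base_form d a0 a1 b1) v w =
    v$0 * w$5 + v$5 * w$0 + b1 * (v$1 * w$2 + v$2 * w$1 + v$3 * w$4 + v$4 * w$3)"
  by (simp add: polar_form_def base_form_def lift6_def cone_form_def power2_eq_square
      char_two[OF assms] ring_distribs ac_simps)

lemma quadratic_form_base_form: "quadratic_form (base_form d a0 a1 b1)"
proof -
  \<comment> \<open>Each mixed term is entered once, above the diagonal, which avoids dividing by
    two. Index \<open>5\<close> stands for the coordinate \<open>x$6\<close>.\<close>
  define c :: "6 \<Rightarrow> 6 \<Rightarrow> 'a" where "c i j =
    (if (i, j) = (0, 5) then 1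
     else if (i, j) = (1, 1) \<or> (i, j) = (3, 3) then a1 + b1
     else if (i, j) = (1, 2) \<or> (i, j) = (3, 4) then b1
     else if (i, j) = (2, 2) \<or> (i, j) = (4, 4) then a0 + a1 + a1 * d + b1 * d
     else 0)" for i j
  have "base_form d a0 a1 b1 v = (\<Sum>i\<in>UNIV. \<Sum>j\<in>UNIV. c i j * v $ i * v $ j)" for v
    unfolding UNIV_6
    by (simp add: c_def base_form_def lift6_def cone_form_def power2_eq_square algebra_simps)
  then show ?thesis by (auto simp: quadratic_form_def)
qed

text \<open>The Witt index has to be \<open>3\<close>. A subspace on which the form vanishes is
  isotropic for the polar form, so \<open>isotropic_dim_le\<close> bounds its dimension by
  \<open>3\<close>, and an explicit subspace attains the bound.\<close>

lemma nondegenerate_hyperbolic_base_form: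
  fixes d :: "'a::field"
  assumes two: "(2::'a) = 0" and "b1 \<noteq> 0"
  shows "nondegenerate_hyperbolic (base_form d a0 a1 b1)"
proof -
  let ?Q = "base_form d a0 a1 b1"
  note polar = polar_form_base_form[OF two]
  have rad: "v = 0" if "\<And>w. polar_form ?Q v w = 0" for v
  proof -
    \<comment> \<open>Pairing with the six unit vectors returns each coordinate of \<open>v\<close>,
      some of them multiplied by \<open>b1\<close>.\<close>
    have "v $ i = 0" for i
      using that[of "axis 0 1"] that[of "axis 1 1"] that[of "axis 2 1"] that[of "axis 3 1"]
        that[of "axis 4 1"] that[of "axis 5 1"] \<open>b1 \<noteq> 0\<close> exhaust_6[of i]
      by (auto simp: polar axis_def)
    then show ?thesis by (simp add: vec_eq_iff)
  qed
  have upper: "vec.dim W \<le> 3" if W: "vec.subspace W" "\<forall>w\<in>W. ?Q w = 0" for W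
  proof -
    have "2 * vec.dim W \<le> CARD(6)"
    proof (rule isotropic_dim_le[of "polar_form ?Q"])
      \<comment> \<open>The vectors \<open>x\<close>, \<open>y\<close> and \<open>x + y\<close> all
        lie in \<open>W\<close>, so the three values in the polar form vanish.\<close>
      show "polar_form ?Q x y = 0" if "x \<in> W" "y \<in> W" for x y
        using that W by (simp add: polar_form_def vec.subspace_add)
    qed (use rad W(1) in \<open>simp_all add: polar algebra_simps\<close>)
    then show ?thesis by simp
  qed
  \<comment> \<open>This parametrizes the subspace with \<open>y$0 = 0\<close>,
    \<open>y$1 = y$3\<close>, \<open>y$2 = y$4\<close>. There the terms in coordinates
    \<open>1, 2\<close> equal those in \<open>3, 4\<close> and cancel them.\<close>
  define f :: "'a ^ 3 \<Rightarrow> 'a ^ 6" where "f x = (\<chi> i. if i = 1 \<or> i = 3 then x $ 1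
    else if i = 2 \<or> i = 4 then x $ 2 else if i = 5 then x $ 3 else 0)" for x
  have lin: "Vector_Spaces.linear (*s) (*s) f"
    by unfold_locales (simp_all add: f_def vec_eq_iff algebra_simps)
  interpret f: Vector_Spaces.linear "(*s)" "(*s)" f by (rule lin)
  have "inj f"
    by (auto simp: inj_def f_def vec_eq_iff forall_3 forall_6)
  then have "vec.dim (range f) = vec.dim (UNIV :: ('a ^ 3) set)"
    by (intro vec.dim_image_eq[OF lin]) simp
  then have "vec.dim (range f) = 3" by (simp add: card_cart_basis)
  moreover have "vec.subspace (range f)" by (intro f.subspace_image vec.subspace_UNIV)
  moreover have "?Q (f x) = 0" for x
    by (simp add: f_def base_form_def lift6_def cone_form_def char_two[OF two] ac_simps ring_distribs)
  ultimately have mem: "3 \<in> {vec.dim W | W. vec.subspace W \<and> (\<forall>w\<in>W. ?Q w = 0)}" (is "_ \<in> ?D")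
    by (intro CollectI exI[of _ "range f"]) auto
  have le: "n \<le> 3" if "n \<in> ?D" for n
    using that upper by blast
  then have "finite ?D"
    by (meson finite_nat_set_iff_bounded_le)
  then have "witt_index ?Q = 3"
    unfolding witt_index_def using le mem by (rule Max_eqI)
  moreover have "nondegenerate ?Q"
    using rad by (simp add: nondegenerate_def)
  ultimately show ?thesis
    by (simp add: nondegenerate_hyperbolic_def quadratic_form_base_form)
qed

section \<open>The quadratic extension\<close>

text \<open>Translation by \<open>1\<close> permutes the field; summing all elements before and
  after shows that the order of the field is zero in it.\<close>

lemma two_eq_0_if_card_power2:
  assumes "CARD('a::{field,finite}) = 2 ^ h"
  shows "(2::'a) = 0"
proof -
  have "(\<Sum>x\<in>UNIV. x + 1) = (\<Sum>x\<in>UNIV. x :: 'a)"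
    by (rule sum.reindex_bij_witness[of _ "\<lambda>x. x - 1" "\<lambda>x. x + 1"]) auto
  then have "of_nat CARD('a) = (0::'a)" by (simp add: sum.distrib)
  then show ?thesis using assms by simp
qed

text \<open>Multiplication by a nonzero \<open>x\<close> permutes the nonzero elements; comparing
  their products gives \<open>x ^ (CARD('a) - 1) = 1\<close>.\<close>

lemma power_card_eq_same:
  fixes x :: "'a::{field,finite}"
  shows "x ^ CARD('a) = x"
proof (cases "x = 0")
  case False
  let ?P = "\<Prod>y\<in>UNIV - {0::'a}. y"
  have "?P = (\<Prod>y\<in>UNIV - {0}. x * y)"
    by (rule prod.reindex_bij_witness[of _ "\<lambda>y. x * y" "\<lambda>y. y / x"]) (use False in auto)
  also have "\<dots> = x ^ (CARD('a) - 1) * ?P"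
    by (simp add: prod.distrib)
  finally have "x ^ (CARD('a) - 1) = 1" by simp
  moreover have "CARD('a) = Suc (CARD('a) - 1)" by simp
  ultimately show ?thesis by (metis mult.right_neutral power_Suc)
qed simp

text \<open>The cross term of a square has the factor \<open>2\<close>; the general case iterates
  squaring.\<close>

lemma frobenius_add:
  fixes x y :: "'a::field"
  assumes "(2::'a) = 0"
  shows "(x + y) ^ 2 ^ n = x ^ 2 ^ n + y ^ 2 ^ n"
proof (induction n)
  case (Suc n)
  have "(x + y) ^ 2 ^ Suc n = ((x + y) ^ 2 ^ n)\<^sup>2"
    by (simp add: power_mult[symmetric] mult.commute)
  also have "\<dots> = (x ^ 2 ^ n)\<^sup>2 + (y ^ 2 ^ n)\<^sup>2"
    using assms by (simp add: Suc power2_sum)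
  finally show ?case by (simp add: power_mult[symmetric] mult.commute)
qed simp

section \<open>The quadratic extension with basis \<open>(1, \<epsilon>)\<close>\<close>

locale barlotti_cofman =
  fixes \<iota> :: "'f::{field,finite} \<Rightarrow> 'k::{field,finite}"
    and q h :: nat and \<delta> :: 'f and \<epsilon> :: 'k
  assumes q_eq: "q = 2 ^ h" and q_gt_2: "q > 2"
    and card_f: "CARD('f) = q" and card_k: "CARD('k) = q ^ 2"
    and embedding: "field_embedding \<iota>"
    and trace: "abs_trace2 h \<delta> = 1"
    and eps_notin: "\<epsilon> \<notin> range \<iota>" and eps_eq: "\<epsilon> ^ 2 + \<epsilon> + \<iota> \<delta> = 0"
begin

lemma two_f: "(2::'f) = 0"
  using card_f q_eq by (intro two_eq_0_if_card_power2) simp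

lemma two_k: "(2::'k) = 0"
  using card_k q_eq by (intro two_eq_0_if_card_power2[of "h * 2"]) (simp add: power_mult)

lemmas char_f = char_two[OF two_f]
lemmas char_k = char_two[OF two_k]

lemma emb_add: "\<iota> (x + y) = \<iota> x + \<iota> y"
  and emb_mult: "\<iota> (x * y) = \<iota> x * \<iota> y"
  and emb_1: "\<iota> 1 = 1"
  using embedding by (simp_all add: field_embedding_def)

lemma emb_0: "\<iota> 0 = 0"
  using emb_add[of 0 0] by (metis add_left_cancel add.right_neutral)

lemma emb_power: "\<iota> (x ^ n) = \<iota> x ^ n"
  by (induction n) (simp_all add: emb_mult emb_1)

lemma emb_eq_0_iff: "\<iota> x = 0 \<longleftrightarrow> x = 0"
proof
  assume "\<iota> x = 0"
  then have "\<iota> (x * inverse x) = 0" by (simp add: emb_mult)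
  then show "x = 0" using emb_1 by (cases "x = 0") auto
qed (simp add: emb_0)

lemma emb_eq_iff: "\<iota> x = \<iota> y \<longleftrightarrow> x = y"
proof
  assume "\<iota> x = \<iota> y"
  then have "\<iota> (x + y) = 0" by (simp add: emb_add char_k)
  then have "x + y = 0" by (simp add: emb_eq_0_iff)
  then show "x = y" by (metis char_f(2) add.right_neutral)
qed simp

text \<open>A relation with \<open>y \<noteq> 0\<close> could be solved for
  \<open>\<epsilon>\<close>, placing it in the range of \<open>\<iota>\<close>.\<close>

lemma basis_zero_iff: "\<iota> x + \<epsilon> * \<iota> y = 0 \<longleftrightarrow> x = 0 \<and> y = 0"
proof
  assume eq: "\<iota> x + \<epsilon> * \<iota> y = 0"
  have "y = 0"
  proof (rule ccontr)
    assume y: "y \<noteq> 0"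
    have "\<epsilon> * \<iota> y = \<iota> x" using eq by (metis char_k(2) add.right_neutral)
    then have "\<epsilon> * \<iota> (y * inverse y) = \<iota> (x * inverse y)"
      by (metis emb_mult mult.assoc)
    then have "\<epsilon> = \<iota> (x * inverse y)" using y by (simp add: emb_1)
    then show False using eps_notin by blast
  qed
  with eq show "x = 0 \<and> y = 0" by (simp add: emb_eq_0_iff emb_0)
qed (simp add: emb_0)

lemma basis_eq_iff:
  "\<iota> x + \<epsilon> * \<iota> y = \<iota> x' + \<epsilon> * \<iota> y' \<longleftrightarrow> x = x' \<and> y = y'"
proof
  assume "\<iota> x + \<epsilon> * \<iota> y = \<iota> x' + \<epsilon> * \<iota> y'"
  then have "(\<iota> x + \<epsilon> * \<iota> y) + (\<iota> x' + \<epsilon> * \<iota> y') = 0" by (simp only: char_k)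
  then have "\<iota> (x + x') + \<epsilon> * \<iota> (y + y') = 0" by (simp add: emb_add algebra_simps)
  then have "x + x' = 0" "y + y' = 0" by (auto simp: basis_zero_iff)
  then show "x = x' \<and> y = y'" by (metis char_f(2) add.right_neutral)
qed simp

text \<open>By counting: the map from pairs to the extension is injective, and both sides have
  \<open>q ^ 2\<close> elements.\<close>

lemma basis_spans: obtains x y where "c = \<iota> x + \<epsilon> * \<iota> y"
proof -
  let ?f = "\<lambda>p. \<iota> (fst p) + \<epsilon> * \<iota> (snd p)"
  have "inj ?f" by (auto simp: inj_def basis_eq_iff)
  then have "card (range ?f) = CARD('k)"
    by (simp add: card_image card_f card_k power2_eq_square flip: UNIV_Times_UNIV)
  then have "range ?f = UNIV" by (simp add: card_eq_UNIV_imp_eq_UNIV)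
  then have "c \<in> range ?f" by blast
  then show ?thesis using that by blast
qed

section \<open>Coordinates, conjugation and norm\<close>

definition "re c = fst (coords \<iota> \<epsilon> c)"
definition "im c = snd (coords \<iota> \<epsilon> c)"

lemma re_basis [simp]: "re (\<iota> x + \<epsilon> * \<iota> y) = x"
  and im_basis [simp]: "im (\<iota> x + \<epsilon> * \<iota> y) = y"
proof -
  have "coords \<iota> \<epsilon> (\<iota> x + \<epsilon> * \<iota> y) = (x, y)"
    unfolding coords_def by (rule the_equality) (auto simp: basis_eq_iff)
  then show "re (\<iota> x + \<epsilon> * \<iota> y) = x" "im (\<iota> x + \<epsilon> * \<iota> y) = y"
    by (simp_all add: re_def im_def)
qed

lemma re_im: "\<iota> (re c) + \<epsilon> * \<iota> (im c) = c"
  by (rule basis_spans[of c]) simp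

lemma re_imI: "c = \<iota> x + \<epsilon> * \<iota> y \<Longrightarrow> re c = x \<and> im c = y"
  by simp

lemma re_im_eqI: "re c = re d \<Longrightarrow> im c = im d \<Longrightarrow> c = d"
  by (metis re_im)

lemma eps_square: "\<epsilon> * \<epsilon> = \<epsilon> + \<iota> \<delta>"
proof -
  have "\<epsilon> * \<epsilon> + (\<epsilon> + \<iota> \<delta>) = 0" using eps_eq by (simp add: power2_eq_square add.assoc)
  then show ?thesis by (metis char_k(3) add_eq_0_iff2)
qed

lemma re_im_add: "re (c + d) = re c + re d \<and> im (c + d) = im c + im d"
proof (rule re_imI)
  have "c + d = (\<iota> (re c) + \<epsilon> * \<iota> (im c)) + (\<iota> (re d) + \<epsilon> * \<iota> (im d))"
    by (simp only: re_im)
  then show "c + d = \<iota> (re c + re d) + \<epsilon> * \<iota> (im c + im d)"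
    by (simp add: emb_add algebra_simps)
qed

lemma re_im_mult:
  "re (c * d) = re c * re d + \<delta> * (im c * im d) \<and>
   im (c * d) = re c * im d + im c * re d + im c * im d"
proof (rule re_imI)
  have "c * d = (\<iota> (re c) + \<epsilon> * \<iota> (im c)) * (\<iota> (re d) + \<epsilon> * \<iota> (im d))"
    by (simp only: re_im)
  also have "\<dots> = \<iota> (re c) * \<iota> (re d) + \<epsilon> * (\<iota> (re c) * \<iota> (im d) + \<iota> (im c) * \<iota> (re d))
      + (\<epsilon> * \<epsilon>) * (\<iota> (im c) * \<iota> (im d))"
    by (simp add: algebra_simps)
  finally show "c * d = \<iota> (re c * re d + \<delta> * (im c * im d))
      + \<epsilon> * \<iota> (re c * im d + im c * re d + im c * im d)"
    by (simp add: eps_square emb_add emb_mult algebra_simps)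
qed

lemma re_im_emb: "re (\<iota> x) = x \<and> im (\<iota> x) = 0"
  by (rule re_imI) (simp add: emb_0)

lemma re_im_eps: "re \<epsilon> = 0 \<and> im \<epsilon> = 1"
  by (rule re_imI) (simp add: emb_0 emb_1)

lemma re_im_0: "re 0 = 0 \<and> im 0 = 0"
  using re_im_emb[of 0] by (simp add: emb_0)

lemma re_im_1: "re 1 = 1 \<and> im 1 = 0"
  using re_im_emb[of 1] by (simp add: emb_1)

lemmas re_im_simps = re_im_add re_im_mult re_im_emb re_im_eps re_im_0 re_im_1

text \<open>Each squaring replaces \<open>\<epsilon>\<close> by
  \<open>\<epsilon> + \<iota> \<delta>\<close> and squares the sum collected so far. For
  \<open>n = h\<close> the sum is the absolute trace of \<open>\<delta>\<close>.\<close>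

lemma eps_power: "\<epsilon> ^ 2 ^ n = \<epsilon> + \<iota> (\<Sum>i<n. \<delta> ^ 2 ^ i)"
proof (induction n)
  case (Suc n)
  let ?s = "\<Sum>i<n. \<delta> ^ 2 ^ i"
  \<comment> \<open>Squaring raises every index in the sum by one, and the extra
    \<open>\<delta>\<close> fills the place \<open>i = 0\<close>.\<close>
  have "?s\<^sup>2 + \<delta> = (\<Sum>i<Suc n. \<delta> ^ 2 ^ i)"
  proof (induction n)
    case (Suc n)
    have "(\<Sum>i<Suc n. \<delta> ^ 2 ^ i)\<^sup>2 = (\<Sum>i<n. \<delta> ^ 2 ^ i)\<^sup>2 + (\<delta> ^ 2 ^ n)\<^sup>2"
      using frobenius_add[OF two_f, of _ _ 1] by simp
    also have "(\<delta> ^ 2 ^ n)\<^sup>2 = \<delta> ^ 2 ^ Suc n"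
      by (simp add: power_mult[symmetric] mult.commute)
    finally show ?case using Suc by (simp add: ac_simps)
  qed simp
  moreover have "\<epsilon> ^ 2 ^ Suc n = (\<epsilon> ^ 2 ^ n)\<^sup>2"
    by (simp add: power_mult[symmetric] mult.commute)
  moreover have "(\<epsilon> + \<iota> ?s)\<^sup>2 = \<epsilon> + \<iota> (?s\<^sup>2 + \<delta>)"
    using frobenius_add[OF two_k, of \<epsilon> "\<iota> ?s" 1] eps_square
    by (simp add: emb_add emb_mult power2_eq_square ac_simps)
  ultimately show ?case by (simp only: Suc)
qed (simp add: emb_0)

text \<open>The power \<open>q\<close> is additive and fixes the range of \<open>\<iota>\<close>, so
  its value at \<open>\<epsilon>\<close> determines it; this value is \<open>eps_power\<close> at
  \<open>h\<close>.\<close>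

lemma conjugate: "c ^ q = c + \<iota> (im c)"
proof -
  have "\<epsilon> ^ q = \<epsilon> + 1"
    using eps_power[of h] trace by (simp add: abs_trace2_def q_eq emb_1)
  moreover have "\<iota> x ^ q = \<iota> x" for x
    using power_card_eq_same[of x] by (metis card_f emb_power)
  moreover have "(\<iota> (re c) + \<epsilon> * \<iota> (im c)) ^ q = \<iota> (re c) ^ q + (\<epsilon> * \<iota> (im c)) ^ q"
    unfolding q_eq by (rule frobenius_add[OF two_k])
  ultimately have "(\<iota> (re c) + \<epsilon> * \<iota> (im c)) ^ q = \<iota> (re c) + \<epsilon> * \<iota> (im c) + \<iota> (im c)"
    by (simp add: power_mult_distrib algebra_simps)
  then show ?thesis by (simp only: re_im)
qed

text \<open>The norm in coordinates, as an element of the smaller field; \<open>power_Suc_q\<close>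
  identifies its image in the extension.\<close>

definition "nm c = (re c)\<^sup>2 + re c * im c + \<delta> * (im c)\<^sup>2"

lemma power_Suc_q: "c ^ (q + 1) = \<iota> (nm c)"
proof -
  have "c ^ (q + 1) = c * (c + \<iota> (im c))" by (simp add: conjugate)
  also have "\<dots> = \<iota> (nm c)"
    by (rule re_im_eqI)
      (simp_all add: re_im_simps nm_def power2_eq_square char_f ring_distribs ac_simps)
  finally show ?thesis .
qed

lemma conjugate_minus: "c ^ q - c = \<iota> (im c)"
  by (simp add: conjugate)

lemma im_eq_0_iff: "im c = 0 \<longleftrightarrow> c \<in> range \<iota>"
proof
  assume "im c = 0"
  then have "c = \<iota> (re c)" using re_im[of c] by (simp add: emb_0)
  then show "c \<in> range \<iota>" by blast
qed (use re_im_emb in auto)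

section \<open>The Barlotti--Cofman representation\<close>

lemma bc_vec_eq: "bc_vec \<iota> \<epsilon> x0 X Y Z = hom7 x0 (re X) (im X) (re Y) (im Y) (re Z) (im Z)"
  by (simp add: bc_vec_def re_def im_def)

lemma bc_vec_inject:
  "bc_vec \<iota> \<epsilon> x0 X Y Z = bc_vec \<iota> \<epsilon> x0' X' Y' Z' \<longleftrightarrow> x0 = x0' \<and> X = X' \<and> Y = Y' \<and> Z = Z'"
  by (auto simp: bc_vec_eq intro: re_im_eqI)

lemma bc_vec_add:
  "bc_vec \<iota> \<epsilon> x0 X Y Z + bc_vec \<iota> \<epsilon> x0' X' Y' Z' =
     bc_vec \<iota> \<epsilon> (x0 + x0') (X + X') (Y + Y') (Z + Z')"
  by (simp add: bc_vec_eq hom7_add re_im_simps)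

lemma bc_vec_scale:
  "s *s bc_vec \<iota> \<epsilon> x0 X Y Z = bc_vec \<iota> \<epsilon> (s * x0) (\<iota> s * X) (\<iota> s * Y) (\<iota> s * Z)"
  by (simp add: bc_vec_eq hom7_scale re_im_simps)

lemma bc_vec_zero: "bc_vec \<iota> \<epsilon> 0 0 0 0 = 0"
  by (simp add: bc_vec_eq re_im_0 hom7_zero)

lemma bc_vec_eq_0_iff: "bc_vec \<iota> \<epsilon> x0 X Y Z = 0 \<longleftrightarrow> x0 = 0 \<and> X = 0 \<and> Y = 0 \<and> Z = 0"
  by (metis bc_vec_inject bc_vec_zero)

lemma bc_vec_cases: obtains X Y Z where "v = bc_vec \<iota> \<epsilon> (v $ 0) X Y Z"
proof
  show "v = bc_vec \<iota> \<epsilon> (v $ 0) (\<iota> (v $ 1) + \<epsilon> * \<iota> (v $ 2)) (\<iota> (v $ 3) + \<epsilon> * \<iota> (v $ 4))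
      (\<iota> (v $ 5) + \<epsilon> * \<iota> (v $ 6))"
    unfolding bc_vec_eq re_basis im_basis by (simp add: vec_eq_iff forall_7)
qed

lemma bc_vec_0 [simp]: "bc_vec \<iota> \<epsilon> x0 X Y Z $ 0 = x0"
  by (simp add: bc_vec_eq)

text \<open>The functions \<open>im\<close> and \<open>nm\<close> are the trace and norm to the field of order \<open>q\<close>, so this is
  the invariant form of the equation of the cone.\<close>

lemma cone_form_bc_vec:
  "cone_form \<delta> (re a) (im a) b1 (bc_vec \<iota> \<epsilon> x0 X Y Z) =
     x0 * im Z + im (a * (X + Y)\<^sup>2) + b1 * (nm X + nm Y)"
proof -
  have sq: "(X + Y)\<^sup>2 = X * X + Y * Y"
    using frobenius_add[OF two_k, of X Y 1] by (simp add: power2_eq_square)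
  show ?thesis
    unfolding sq
    by (simp add: cone_form_def bc_vec_eq nm_def power2_eq_square re_im_simps char_f
        ring_distribs ac_simps)
qed

text \<open>Uniqueness of the normalized representative makes the definite description in
  \<open>bc_affine\<close> well defined.\<close>

lemma bc_affine_point: "bc_affine \<iota> \<epsilon> (point (hom4 1 X Y Z)) = point (bc_vec \<iota> \<epsilon> 1 X Y Z)"
  unfolding bc_affine_def
  by (rule the_equality) (auto simp: point_normalized_inject)

lemma affine_k_iff:
  "P \<in> affine_points \<longleftrightarrow> (\<exists>X Y Z. P = point (hom4 1 X Y Z))" for P :: "('k ^ 4) set"
  unfolding affine_points_iff by (metis hom4_cases hom4_nth(1))

lemma affine_f_iff:
  "R \<in> affine_points \<longleftrightarrow> (\<exists>X Y Z. R = point (bc_vec \<iota> \<epsilon> 1 X Y Z))" for R :: "('f ^ 7) set"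
  unfolding affine_points_iff by (metis bc_vec_cases bc_vec_0)

lemma infinity_k_iff:
  "P \<in> points_at_infinity \<longleftrightarrow>
     (\<exists>u v w. (u, v, w) \<noteq> (0, 0, 0) \<and> P = point (hom4 0 u v w))" for P :: "('k ^ 4) set"
  unfolding points_at_infinity_iff
  by (metis (no_types, opaque_lifting) Pair_inject hom4_cases hom4_nth(1) hom4_zero)

text \<open>Normalized vectors parametrize the affine points on both sides by the triples
  \<open>(X, Y, Z)\<close> without repetition.\<close>

lemma bc_affine_bij: "bij_betw (bc_affine \<iota> \<epsilon>) affine_points affine_points"
proof (rule bij_betw_imageI)
  show "inj_on (bc_affine \<iota> \<epsilon>) affine_points"
    by (auto simp: inj_on_def affine_k_iff bc_affine_point point_normalized_inject bc_vec_inject)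
  show "bc_affine \<iota> \<epsilon> ` affine_points = affine_points"
  proof (intro equalityI subsetI)
    fix R :: "('f ^ 7) set" assume "R \<in> affine_points"
    then obtain X Y Z where "R = bc_affine \<iota> \<epsilon> (point (hom4 1 X Y Z))"
      by (auto simp: affine_f_iff bc_affine_point)
    then show "R \<in> bc_affine \<iota> \<epsilon> ` affine_points"
      using affine_k_iff by blast
  qed (auto simp: affine_k_iff affine_f_iff bc_affine_point, blast)
qed

section \<open>The equation of the surface\<close>

definition surface_form :: "'k \<Rightarrow> 'k \<Rightarrow> 'k ^ 4 \<Rightarrow> 'k" where
  "surface_form a b v = (let J = v $ 0; X = v $ 1; Y = v $ 2; Z = v $ 3 in
     Z ^ q * J ^ q - Z * J ^ (2 * q - 1) + a ^ q * (X ^ (2 * q) + Y ^ (2 * q))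
       - a * (X ^ 2 + Y ^ 2) * J ^ (2 * q - 2)
     - (b ^ q - b) * (X ^ (q + 1) + Y ^ (q + 1)) * J ^ (q - 1))"

lemma surface_form_scale: "surface_form a b (c *s v) = c ^ (2 * q) * surface_form a b v"
proof -
  \<comment> \<open>Every mixed monomial is written as a product of two powers, even with exponent
    \<open>1\<close>, so that a single rule rescales them all.\<close>
  have monomials: "surface_form a b v = v$3 ^ q * v$0 ^ q - v$3 ^ 1 * v$0 ^ (2 * q - 1)
      + a ^ q * (v$1 ^ (2 * q) + v$2 ^ (2 * q))
      - a * (v$1 ^ 2 * v$0 ^ (2 * q - 2) + v$2 ^ 2 * v$0 ^ (2 * q - 2))
      - (b ^ q - b) * (v$1 ^ (q + 1) * v$0 ^ (q - 1) + v$2 ^ (q + 1) * v$0 ^ (q - 1))" for v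
    by (simp add: surface_form_def Let_def algebra_simps)
  have "(c * x) ^ m * (c * y) ^ n = c ^ (m + n) * (x ^ m * y ^ n)" for x y m n
    by (simp add: power_mult_distrib power_add mult_ac)
  then have scale: "(c * x) ^ m * (c * y) ^ n = c ^ (2 * q) * (x ^ m * y ^ n)"
    if "m + n = 2 * q" for x y m n
    using that by metis
  \<comment> \<open>Since \<open>q > 2\<close>, none of the natural-number subtractions is
    truncated.\<close>
  have exponents: "q + q = 2 * q" "1 + (2 * q - 1) = 2 * q" "2 + (2 * q - 2) = 2 * q"
    "(q + 1) + (q - 1) = 2 * q"
    using q_gt_2 by simp_all
  show ?thesis
    unfolding monomials vector_smult_component exponents[THEN scale] power_mult_distrib[of c _ "2 * q"]
    by (simp only: ring_distribs mult_ac)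
qed

lemma point_in_surface_iff:
  assumes "v \<noteq> 0"
  shows "point v \<in> B_surface q a b \<longleftrightarrow> surface_form a b v = 0"
proof
  assume "point v \<in> B_surface q a b"
  then obtain w where "point v = point w" "surface_form a b w = 0"
    by (auto simp: B_surface_def surface_form_def)
  then show "surface_form a b v = 0"
    using point_eq_iff[OF assms] surface_form_scale by auto
next
  assume "surface_form a b v = 0"
  then show "point v \<in> B_surface q a b"
    using assms by (cases v rule: hom4_cases) (auto simp: B_surface_def surface_form_def)
qed

text \<open>For \<open>J = 1\<close> the terms group into \<open>c ^ q - c\<close> for
  \<open>c = Z\<close> and \<open>c = a * (X + Y)\<^sup>2\<close>, and into norms of
  \<open>X\<close> and \<open>Y\<close>. This is the equation of
  \<open>cone_form_bc_vec\<close>.\<close>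

lemma surface_form_affine:
  "surface_form a b (hom4 1 X Y Z) =
     \<iota> (cone_form \<delta> (re a) (im a) (im b) (bc_vec \<iota> \<epsilon> 1 X Y Z))"
proof -
  have sq: "X\<^sup>2 + Y\<^sup>2 = (X + Y)\<^sup>2" for X Y :: 'k
    using frobenius_add[OF two_k, of X Y 1] by simp
  have "X ^ (2 * q) + Y ^ (2 * q) = ((X + Y)\<^sup>2) ^ q"
    using sq frobenius_add[OF two_k, of "X\<^sup>2" "Y\<^sup>2" h] by (simp add: power_mult q_eq)
  then have "surface_form a b (hom4 1 X Y Z) = (Z ^ q - Z)
      + ((a * (X + Y)\<^sup>2) ^ q - a * (X + Y)\<^sup>2) - (b ^ q - b) * (X ^ (q + 1) + Y ^ (q + 1))"
    unfolding surface_form_def Let_def hom4_nth power_one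
    by (simp only: sq power_mult_distrib) (simp add: algebra_simps)
  then show ?thesis
    unfolding conjugate_minus power_Suc_q cone_form_bc_vec
    by (simp add: char_k emb_add emb_mult)
qed

text \<open>For \<open>J = 0\<close> only \<open>a ^ q * (X + Y) ^ (2 * q)\<close> survives, because
  all exponents of \<open>J\<close> are positive.\<close>

lemma surface_form_infinity:
  assumes "a \<noteq> 0"
  shows "surface_form a b (hom4 0 X Y Z) = 0 \<longleftrightarrow> X = Y"
proof -
  have "X ^ (2 * q) + Y ^ (2 * q) = (X + Y) ^ 2 ^ (h + 1)"
    unfolding frobenius_add[OF two_k] by (simp add: q_eq)
  moreover have "X + Y = 0 \<longleftrightarrow> X = Y"
    by (metis char_k(1,2) add.right_neutral)
  moreover have "(0::'k) ^ q = 0" "(0::'k) ^ (2 * q - 1) = 0" "(0::'k) ^ (2 * q - 2) = 0"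
    "(0::'k) ^ (q - 1) = 0"
    using q_gt_2 by (intro zero_power; simp)+
  ultimately show ?thesis
    using assms unfolding surface_form_def Let_def hom4_nth by (simp only:) simp
qed

section \<open>Spread lines\<close>

lemma spread_line_point:
  assumes "(u, v, w) \<noteq> (0, 0, 0)"
  shows "spread_line \<iota> \<epsilon> (point (hom4 0 u v w)) =
    {point (bc_vec \<iota> \<epsilon> 0 (l * u) (l * v) (l * w)) | l. l \<noteq> 0}" (is "?L = ?R")
proof
  show "?R \<subseteq> ?L" by (auto simp: spread_line_def)
  show "?L \<subseteq> ?R"
  proof
    fix S assume "S \<in> ?L"
    then obtain l u' v' w' where l: "l \<noteq> 0" "point (hom4 0 u v w) = point (hom4 0 u' v' w')"
      and S: "S = point (bc_vec \<iota> \<epsilon> 0 (l * u') (l * v') (l * w'))"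
      by (auto simp: spread_line_def)
    have "hom4 0 u v w \<noteq> 0" using assms by (simp add: hom4_zero)
    then obtain c where c: "c \<noteq> 0" "hom4 0 u v w = c *s hom4 0 u' v' w'"
      using l(2) by (auto simp: point_eq_iff)
    \<comment> \<open>The factor between two representatives of the point is absorbed into
      \<open>l\<close>.\<close>
    then have "u' = u / c" "v' = v / c" "w' = w / c" by (auto simp: hom4_scale)
    then have "S = point (bc_vec \<iota> \<epsilon> 0 ((l / c) * u) ((l / c) * v) ((l / c) * w))"
      using S by simp
    moreover have "l / c \<noteq> 0" using l(1) c(1) by simp
    ultimately show "S \<in> ?R" by blast
  qed
qed

text \<open>The point with \<open>l = 1\<close> on the first line also lies on the second. This
  makes the two vectors at infinity proportional over the extension, with factor
  \<open>\<iota> c * l\<close>.\<close>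

lemma spread_line_inject: "inj_on (spread_line \<iota> \<epsilon>) points_at_infinity"
proof (rule inj_onI)
  fix P R :: "('k ^ 4) set"
  assume PR: "P \<in> points_at_infinity" "R \<in> points_at_infinity"
    and eq: "spread_line \<iota> \<epsilon> P = spread_line \<iota> \<epsilon> R"
  obtain u v w where P: "(u, v, w) \<noteq> (0, 0, 0)" "P = point (hom4 0 u v w)"
    using PR(1) infinity_k_iff by blast
  obtain u' v' w' where R: "(u', v', w') \<noteq> (0, 0, 0)" "R = point (hom4 0 u' v' w')"
    using PR(2) infinity_k_iff by blast
  have "point (bc_vec \<iota> \<epsilon> 0 u v w) \<in> spread_line \<iota> \<epsilon> P"
    unfolding P(2) spread_line_point[OF P(1)] by (force intro: exI[of _ 1])
  then obtain l where l: "l \<noteq> 0"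
    "point (bc_vec \<iota> \<epsilon> 0 u v w) = point (bc_vec \<iota> \<epsilon> 0 (l * u') (l * v') (l * w'))"
    unfolding eq R(2) spread_line_point[OF R(1)] by blast
  have "bc_vec \<iota> \<epsilon> 0 u v w \<noteq> 0" using P(1) by (simp add: bc_vec_eq_0_iff)
  then obtain c where c: "c \<noteq> 0"
    "bc_vec \<iota> \<epsilon> 0 u v w = c *s bc_vec \<iota> \<epsilon> 0 (l * u') (l * v') (l * w')"
    using l(2) by (auto simp: point_eq_iff)
  then have "hom4 0 u v w = (\<iota> c * l) *s hom4 0 u' v' w'"
    by (simp add: bc_vec_scale bc_vec_inject hom4_scale mult.assoc)
  moreover have "hom4 0 u v w \<noteq> 0" using P(1) by (simp add: hom4_zero)
  moreover have "\<iota> c * l \<noteq> 0" using c(1) l(1) by (simp add: emb_eq_0_iff)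
  ultimately show "P = R" unfolding P(2) R(2) using point_eq_iff by blast
qed

text \<open>The multiples of \<open>(u, v, w)\<close> form the image of the extension under an
  injective map that is linear over the smaller field, hence a two-dimensional subspace.\<close>

lemma spread_line_in_pg_lines:
  assumes "P \<in> points_at_infinity"
  shows "spread_line \<iota> \<epsilon> P \<in> pg_lines"
proof -
  obtain u v w where P: "(u, v, w) \<noteq> (0, 0, 0)" "P = point (hom4 0 u v w)"
    using assms infinity_k_iff by blast
  define f where "f l = bc_vec \<iota> \<epsilon> 0 (l * u) (l * v) (l * w)" for l
  have f0: "f l = 0 \<longleftrightarrow> l = 0" for l
    using P(1) by (auto simp: f_def bc_vec_eq_0_iff)
  have add: "f (l + m) = f l + f m" for l m
    by (simp add: f_def bc_vec_add distrib_right)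
  have scale: "f (\<iota> s * l) = s *s f l" for s l
    by (simp add: f_def bc_vec_scale mult.assoc)
  have f_basis: "f (\<iota> x + \<epsilon> * \<iota> y) = x *s f 1 + y *s f \<epsilon>" for x y
    using scale[of x 1] scale[of y \<epsilon>] by (simp add: add mult.commute)
  have "vec.span {f 1, f \<epsilon>} = {x *s f 1 + y *s f \<epsilon> | x y. True}"
    by (auto simp: vec.span_insert vec.span_singleton algebra_simps) 
  also have "\<dots> = range f"
  proof (intro equalityI subsetI)
    fix z assume "z \<in> range f"
    then obtain l where "z = f l" by blast
    moreover obtain x y where "l = \<iota> x + \<epsilon> * \<iota> y" by (rule basis_spans)
    ultimately show "z \<in> {x *s f 1 + y *s f \<epsilon> | x y. True}" using f_basis by blast
  qed (use f_basis in \<open>auto simp: image_iff, metis\<close>)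
  finally have span: "vec.span {f 1, f \<epsilon>} = range f" .
  \<comment> \<open>Otherwise \<open>f\<close> would vanish at
    \<open>\<iota> s + \<epsilon>\<close>, which is nonzero; signs do not matter in characteristic
    two.\<close>
  have "f \<epsilon> \<notin> vec.span {f 1}"
  proof
    assume "f \<epsilon> \<in> vec.span {f 1}"
    then obtain s where "f \<epsilon> = s *s f 1" by (auto simp: vec.span_singleton)
    then have "f (\<iota> s + \<epsilon> * \<iota> 1) = 0"
      by (simp add: f_basis char_f flip: vec.scale_left_distrib)
    then show False by (simp add: f0 basis_zero_iff)
  qed
  moreover have "f 1 \<noteq> 0" by (simp add: f0)
  ultimately have "vec.dim {f \<epsilon>, f 1} = 2"
    by (simp add: vec.dim_insert)
  then have "vec.dim (range f) = 2"
    using span vec.dim_span[of "{f 1, f \<epsilon>}"] by (simp add: insert_commute)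
  moreover have sub: "vec.subspace (range f)"
    using vec.subspace_span[of "{f 1, f \<epsilon>}"] by (simp add: span)
  moreover have "spread_line \<iota> \<epsilon> P = {S \<in> pg_points. S \<subseteq> range f}"
  proof -
    have "{S \<in> pg_points. S \<subseteq> range f} = {point (f l) | l. l \<noteq> 0}"
    proof (intro equalityI subsetI)
      fix S assume "S \<in> {S \<in> pg_points. S \<subseteq> range f}"
      then obtain v where "v \<noteq> 0" "S = point v" "v \<in> range f"
        using point_subset_iff[OF sub] by (auto simp: pg_points_def)
      then show "S \<in> {point (f l) | l. l \<noteq> 0}" using f0 by blast
    next
      fix S assume "S \<in> {point (f l) | l. l \<noteq> 0}"
      then obtain l where "l \<noteq> 0" "S = point (f l)" by blast
      then show "S \<in> {S \<in> pg_points. S \<subseteq> range f}"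
        using f0 by (simp add: point_in_pg_points point_subset_iff[OF sub])
    qed
    then show ?thesis by (simp add: P(2) spread_line_point[OF P(1)] f_def)
  qed
  ultimately show ?thesis by (auto simp: pg_lines_def)
qed

section \<open>Comparison of the surface with the cone\<close>

lemma surface_affine_iff:
  assumes "P \<in> affine_points"
  shows "P \<in> B_surface q a b \<longleftrightarrow>
    bc_affine \<iota> \<epsilon> P \<in> quadric (cone_form \<delta> (re a) (im a) (im b))"
proof -
  obtain X Y Z where P: "P = point (hom4 1 X Y Z)"
    using assms affine_k_iff by blast
  have "hom4 1 X Y Z \<noteq> 0" "bc_vec \<iota> \<epsilon> 1 X Y Z \<noteq> 0"
    by (simp_all add: hom4_zero bc_vec_eq_0_iff)
  then show ?thesis
    by (simp add: P bc_affine_point point_in_surface_iff surface_form_affine emb_eq_0_iff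
        cone_quadric_iff)
qed

lemma surface_infinity_iff:
  fixes a :: 'k
  assumes "a \<noteq> 0" "(u, v, w) \<noteq> (0, 0, 0)"
  shows "point (hom4 0 u v w) \<in> B_surface q a b \<longleftrightarrow> u = v"
  using assms by (subst point_in_surface_iff) (auto simp: hom4_zero surface_form_infinity)

text \<open>Evaluating the form at the multiples of \<open>(u, v, w)\<close> by \<open>1\<close>, \<open>\<epsilon>\<close> and \<open>1 + \<epsilon>\<close> suffices to
  recover both \<open>nm u + nm v\<close> (by polarization) and \<open>a * (u + v)\<^sup>2\<close>.\<close>

lemma spread_line_subset_iff:
  assumes "a \<noteq> 0" "im b \<noteq> 0" "(u, v, w) \<noteq> (0, 0, 0)"
  shows "spread_line \<iota> \<epsilon> (point (hom4 0 u v w)) \<subseteq> quadric (cone_form \<delta> (re a) (im a) (im b))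
    \<longleftrightarrow> u = v"
proof -
  let ?g = "\<lambda>l. im (a * (l * u + l * v)\<^sup>2) + im b * (nm (l * u) + nm (l * v))"
  have mem: "point (bc_vec \<iota> \<epsilon> 0 (l * u) (l * v) (l * w))
      \<in> quadric (cone_form \<delta> (re a) (im a) (im b)) \<longleftrightarrow> ?g l = 0" if "l \<noteq> 0" for l
    using assms(3) that by (subst cone_quadric_iff) (auto simp: bc_vec_eq_0_iff cone_form_bc_vec)
  have iff: "spread_line \<iota> \<epsilon> (point (hom4 0 u v w)) \<subseteq> quadric (cone_form \<delta> (re a) (im a) (im b))
      \<longleftrightarrow> (\<forall>l. l \<noteq> 0 \<longrightarrow> ?g l = 0)"
    unfolding spread_line_point[OF assms(3)] using mem by auto
  show ?thesis
    unfolding iff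
  proof
    assume all: "\<forall>l. l \<noteq> 0 \<longrightarrow> ?g l = 0"
    define A where "A = a * (u + v)\<^sup>2"
    define M where "M = im b * (nm u + nm v)"
    have nm_mult: "nm (c * d) = nm c * nm d" for c d
    proof -
      have "\<iota> (nm (c * d)) = \<iota> (nm c * nm d)"
        unfolding emb_mult by (simp only: power_mult_distrib flip: power_Suc_q)
      then show ?thesis by (simp add: emb_eq_iff)
    qed
    \<comment> \<open>Since the norm is multiplicative, \<open>u\<close> and \<open>v\<close> enter
      only through \<open>A\<close> and \<open>M\<close>.\<close>
    have g: "?g l = im (A * l\<^sup>2) + M * nm l" for l
    proof -
      have "a * (l * u + l * v)\<^sup>2 = A * l\<^sup>2"
        by (simp add: A_def power2_eq_square algebra_simps)
      then show ?thesis by (simp add: M_def nm_mult algebra_simps)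
    qed
    have "(1::'k) \<noteq> 0" "\<epsilon> \<noteq> 0" "1 + \<epsilon> \<noteq> 0"
      using re_im_simps by (simp, metis zero_neq_one, metis add_0 zero_neq_one)
    note eqs = this[THEN all[rule_format]]
    have 1: "im A + M = 0"
      using eqs(1) unfolding g by (simp add: nm_def re_im_simps power2_eq_square)
    have 2: "re A + im A + im A * \<delta> + M * \<delta> = 0"
      using eqs(2) unfolding g by (simp add: nm_def re_im_simps power2_eq_square algebra_simps)
    have 3: "re A + im A * \<delta> + M * \<delta> = 0"
    proof -
      have "(1 + \<epsilon>)\<^sup>2 = 1 + \<epsilon> * \<epsilon>"
        using frobenius_add[OF two_k, of 1 \<epsilon> 1] by (simp add: power2_eq_square)
      then have "im (A * (1 + \<epsilon> * \<epsilon>)) + M * nm (1 + \<epsilon>) = 0"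
        using eqs(3) unfolding g by simp
      then show ?thesis
        by (simp add: nm_def re_im_simps power2_eq_square char_f ring_distribs ac_simps)
    qed
    \<comment> \<open>The equations at \<open>\<epsilon>\<close> and \<open>1 + \<epsilon>\<close>
      differ exactly by \<open>im A\<close>; the equation at \<open>1\<close> then gives
      \<open>M = 0\<close>, and the third gives \<open>re A = 0\<close>.\<close>
    have "im A + (re A + im A * \<delta> + M * \<delta>) = 0" using 2 by (simp add: ac_simps)
    then have imA: "im A = 0" using 3 by simp
    then have "M = 0" using 1 by simp
    then have "re A = 0" using 3 imA by simp
    then have "A = 0" using imA re_im_eqI[of A 0] by (simp add: re_im_0)
    then have "u + v = 0" using assms(1) by (simp add: A_def)
    then show "u = v" by (metis char_k(2) add.right_neutral)
  next
    assume "u = v"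
    then show "\<forall>l. l \<noteq> 0 \<longrightarrow> ?g l = 0" by (simp add: char_k char_f re_im_0)
  qed
qed

text \<open>The points at infinity form the line \<open>X = Y\<close> of the plane
  \<open>J = 0\<close>: one point \<open>(0, 1, 1, z)\<close> for each \<open>z\<close> in the
  extension, and \<open>(0, 0, 0, 1)\<close>.\<close>

lemma card_surface_infinity:
  fixes a :: 'k
  assumes "a \<noteq> 0"
  shows "card (B_surface q a b \<inter> points_at_infinity) = q ^ 2 + 1"
proof -
  let ?f = "\<lambda>z. point (hom4 0 1 1 z :: 'k ^ 4)"
  let ?e = "point (hom4 0 0 0 1 :: 'k ^ 4)"
  have "B_surface q a b \<inter> points_at_infinity = insert ?e (range ?f)"
  proof (intro equalityI subsetI)
    fix P assume "P \<in> B_surface q a b \<inter> points_at_infinity"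
    then obtain u v w where uvw: "(u, v, w) \<noteq> (0, 0, 0)" "P = point (hom4 0 u v w)"
      "P \<in> B_surface q a b"
      using infinity_k_iff by blast
    then have "u = v" using surface_infinity_iff[OF assms uvw(1)] by simp
    with uvw have P: "(u, w) \<noteq> (0, 0)" "P = point (hom4 0 u u w)" by auto
    then have nz: "hom4 0 u u w \<noteq> 0" by (simp add: hom4_zero)
    show "P \<in> insert ?e (range ?f)"
    proof (cases "u = 0")
      case True
      then have "hom4 0 u u w = w *s hom4 0 0 0 1" by (simp add: hom4_scale)
      then have "P = ?e" unfolding P(2) point_eq_iff[OF nz] using P(1) True by blast
      then show ?thesis by blast
    next
      case False
      then have "hom4 0 u u w = u *s hom4 0 1 1 (w / u)" by (simp add: hom4_scale)
      then have "P = ?f (w / u)" unfolding P(2) point_eq_iff[OF nz] using False by blast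
      then show ?thesis by blast
    qed
  next
    fix P assume "P \<in> insert ?e (range ?f)"
    then have "\<exists>u w. (u, u, w) \<noteq> (0, 0, 0) \<and> P = point (hom4 0 u u w)"
      by (metis Pair_inject image_iff insertE zero_neq_one)
    then obtain u w where "(u, u, w) \<noteq> (0, 0, 0)" "P = point (hom4 0 u u w)" by blast
    then show "P \<in> B_surface q a b \<inter> points_at_infinity"
      using surface_infinity_iff[OF assms] infinity_k_iff by blast
  qed
  moreover have "inj ?f" "?e \<notin> range ?f"
    by (auto simp: inj_def point_eq_iff hom4_zero hom4_scale)
  ultimately show ?thesis
    by (simp add: card_insert_if card_image card_k)
qed

end

theorem theorem6p2:
  fixes \<iota> :: "'f::{field,finite} \<Rightarrow> 'k::{field,finite}"
    and q h :: nat
    and \<delta> a0 a1 b0 b1 :: 'f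
    and \<epsilon> a b :: 'k
  assumes "q = 2 ^ h" and "q > 2"
    and "CARD('f) = q" and "CARD('k) = q ^ 2"
    and "field_embedding \<iota>"
    and "abs_trace2 h \<delta> = 1"
    and "\<epsilon> \<notin> range \<iota>" and "\<epsilon> ^ 2 + \<epsilon> + \<iota> \<delta> = 0"
    and "a = \<iota> a0 + \<epsilon> * \<iota> a1" and "a \<noteq> 0"
    and "b = \<iota> b0 + \<epsilon> * \<iota> b1" and "b \<notin> range \<iota>"
  defines "B \<equiv> B_surface q a b"
    and "B' \<equiv> quadric (cone_form \<delta> a0 a1 b1)"
    and "Base \<equiv> quadric (base_form \<delta> a0 a1 b1)"
    and "V \<equiv> point (hom7 0 0 0 0 0 1 0)"
    and "L \<equiv> spread_line \<iota> \<epsilon> ` (B_surface q a b \<inter> points_at_infinity)"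
  shows
    "nondegenerate_hyperbolic (base_form \<delta> a0 a1 b1)
     \<and> B' = cone_over V ((\<lambda>P. lift6 ` P) ` Base)
     \<and> bij_betw (bc_affine \<iota> \<epsilon>) (B \<inter> affine_points) (B' \<inter> affine_points)
     \<and> L \<subseteq> spread \<iota> \<epsilon> \<and> L \<subseteq> pg_lines \<and> card L = q ^ 2 + 1 \<and> (\<forall>l\<in>L. l \<subseteq> B')
     \<and> B = {P \<in> affine_points. bc_affine \<iota> \<epsilon> P \<in> B'}
           \<union> {P \<in> points_at_infinity. spread_line \<iota> \<epsilon> P \<subseteq> B'}"
proof -
  interpret barlotti_cofman \<iota> q h \<delta> \<epsilon>
    by unfold_locales fact+
  have a: "re a = a0" "im a = a1" using assms(9) by simp_all
  \<comment> \<open>That \<open>b\<close> lies outside the smaller field means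
    \<open>b1 \<noteq> 0\<close>, which gives the non-degeneracy of the base.\<close>
  have b: "im b = b1" "im b \<noteq> 0"
    using assms(11) im_eq_0_iff[of b] \<open>b \<notin> range \<iota>\<close> by (simp, blast)
  have affine: "P \<in> B \<longleftrightarrow> bc_affine \<iota> \<epsilon> P \<in> B'" if "P \<in> affine_points" for P
    using surface_affine_iff[OF that, of a b] by (simp add: B_def B'_def a b)
  have infinity: "P \<in> B \<longleftrightarrow> spread_line \<iota> \<epsilon> P \<subseteq> B'" if P: "P \<in> points_at_infinity" for P
  proof -
    obtain u v w where "(u, v, w) \<noteq> (0, 0, 0)" "P = point (hom4 0 u v w)"
      using P infinity_k_iff by blast
    then show ?thesis
      using surface_infinity_iff[OF \<open>a \<noteq> 0\<close>] spread_line_subset_iff[OF \<open>a \<noteq> 0\<close> b(2)]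
      by (simp add: B_def B'_def a b)
  qed
  have "B \<subseteq> pg_points" by (auto simp: B_def B_surface_def intro: point_in_pg_points)
  then have "B = {P \<in> affine_points. bc_affine \<iota> \<epsilon> P \<in> B'}
      \<union> {P \<in> points_at_infinity. spread_line \<iota> \<epsilon> P \<subseteq> B'}"
    using affine infinity unfolding pg_points_eq by blast
  moreover have "bij_betw (bc_affine \<iota> \<epsilon>) (B \<inter> affine_points) (B' \<inter> affine_points)"
  proof -
    \<comment> \<open>Membership agrees point by point, so the bijection between all affine points
      restricts.\<close>
    have "bc_affine \<iota> \<epsilon> ` (B \<inter> affine_points) = B' \<inter> affine_points"
      using affine bij_betw_imp_surj_on[OF bc_affine_bij] by (auto 0 3)
    then show ?thesis
      using bij_betw_subset[OF bc_affine_bij, of "B \<inter> affine_points"] by simp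
  qed
  moreover have "card L = q ^ 2 + 1"
    unfolding L_def card_surface_infinity[OF \<open>a \<noteq> 0\<close>, of b, symmetric]
    by (intro card_image inj_on_subset[OF spread_line_inject]) simp
  moreover have "L \<subseteq> pg_lines"
    using spread_line_in_pg_lines by (auto simp: L_def)
  moreover have "\<forall>l\<in>L. l \<subseteq> B'"
    using infinity by (auto simp: L_def B_def)
  moreover have "B' = cone_over V ((\<lambda>P. lift6 ` P) ` Base)"
    unfolding B'_def V_def Base_def by (rule cone_over_base)
  moreover have "nondegenerate_hyperbolic (base_form \<delta> a0 a1 b1)"
    using nondegenerate_hyperbolic_base_form[OF two_f] b by simp
  moreover have "L \<subseteq> spread \<iota> \<epsilon>"
    by (auto simp: L_def spread_def)
  ultimately show ?thesis by (intro conjI)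
qed

end
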